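(* Let $x_1,\dots,x_N\in\mathbb{R}$ be pairwise distinct, let $l_1,\dots,l_N\ge1$ be integers, and put $P=\sum_{j=1}^N l_j+N$. Let $a_{i,j}\in\mathbb{R}$ ($1\le j\le N$, $0\le i\le l_j-1$) with $a_{l_j-1,j}\ne0$ for $j=1,\dots,N$, and let $$m_k=\sum_{j=1}^{N}\sum_{i=0}^{l_j-1}a_{i,j}\,k(k-1)\cdots(k-i+1)\,x_j^{k-i},\qquad k=0,1,\dots,P-1,$$ be the exact unperturbed moments. Let $\widetilde m_0,\dots,\widetilde m_{P-1}$ be perturbations of these moments such that $\max_{k}|m_k-\widetilde m_k|<\varepsilon$. Then, for sufficiently small $\varepsilon$, the perturbed confluent Prony system $$\sum_{j=1}^{N}\sum_{i=0}^{l_j-1}\widetilde a_{i,j}\,k(k-1)\cdots(k-i+1)\,\widetilde x_j^{\,k-i}=\widetilde m_k,\qquad k=0,1,\dots,P-1,$$ has a unique solution $(\{\widetilde a_{i,j}\},\{\widetilde x_j\})$, and this solution satisfies, for every $j=1,\dots,N$, $$|\widetilde a_{i,j}-a_{i,j}|\le\begin{cases}C_2\,\varepsilon, & i=0,\\[2pt] C_2\,\varepsilon\left(1+\dfrac{|a_{i-1,j}|}{|a_{l_j-1,j}|}\right), & 1\le i\le l_j-1,\end{cases}$$ $$|\widetilde x_j-x_j|\le C_2\,\varepsilon\,\frac{1}{|a_{l_j-1,j}|},$$ where $C_2$ is a constant depending only on the nodes $x_1,\dots,x_N$ and the multiplicities $l_1,\dots,l_N$.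
   Context: The product $k(k-1)\cdots(k-i+1)$ has $i$ factors, equals $1$ for $i=0$, and is zero for $k<i$, in which case the corresponding term is taken to be $0$ (also when the node is $0$); the convention $0^0=1$ is used. The number $P$ of equations equals the number of unknowns $\{a_{i,j}\},\{x_j\}$. The moments $m_k$ are those associated, by the displayed formula, with the model distribution $\sum_{j=1}^{N}\sum_{i=0}^{l_j-1}a_{i,j}\,\delta^{(i)}(x-x_j)$, where $\delta$ is the Dirac delta function.
   Formalization: "Unique solution" is formalized as uniqueness within a fixed neighbourhood (depending on the nodes, multiplicities and coefficients) of the unperturbed solution, since global uniqueness fails (renumbering of nodes; for N=1, l_1=2, a_0≠0 there is a second real solution). *)

theory Defs
  imports Complex_Main
begin

text \<open>
  The multiplicities are \<open>l j\<close>, the coefficients \<open>a i j\<close> and the nodes \<open>x j\<close>,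
  with \<open>j \<in> {1..N}\<close> and \<open>i < l j\<close>. Values of \<open>l\<close>, \<open>a\<close>, \<open>x\<close> outside these index
  ranges are irrelevant.
\<close>

text \<open>Number of unknowns \<open>a i j\<close>, \<open>x j\<close>, which is also the number of equations.\<close>
definition prony_size :: "nat \<Rightarrow> (nat \<Rightarrow> nat) \<Rightarrow> nat" where
  "prony_size N l = (\<Sum>j=1..N. l j) + N"

text \<open>
  The product \<open>k (k - 1) \<dots> (k - i + 1)\<close> is taken over the reals and vanishes for \<open>k < i\<close>,
  so the truncated subtraction in the exponent is harmless (also for a zero node), and
  \<open>0 ^ 0 = 1\<close>.
\<close>
definition prony_moment ::
  "nat \<Rightarrow> (nat \<Rightarrow> nat) \<Rightarrow> (nat \<Rightarrow> nat \<Rightarrow> real) \<Rightarrow> (nat \<Rightarrow> real) \<Rightarrow> nat \<Rightarrow> real" where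
  "prony_moment N l a x k =
     (\<Sum>j=1..N. \<Sum>i<l j. a i j * (\<Prod>t<i. real k - real t) * x j ^ (k - i))"

definition prony_solution ::
  "nat \<Rightarrow> (nat \<Rightarrow> nat) \<Rightarrow> (nat \<Rightarrow> real) \<Rightarrow> (nat \<Rightarrow> nat \<Rightarrow> real) \<Rightarrow> (nat \<Rightarrow> real) \<Rightarrow> bool" where
  "prony_solution N l m a x \<longleftrightarrow> (\<forall>k<prony_size N l. prony_moment N l a x k = m k)"

text \<open>
  Uniqueness of solutions of the perturbed system is local, i.e. within a box of this form around the
  unperturbed parameters: renumbering nodes of equal multiplicity always gives further solutions,
  and so may the system itself, even for \<open>N = 1\<close>. For \<open>l 1 = 2\<close>, eliminating \<open>a 0 1\<close> and
  \<open>a 1 1\<close> leaves \<open>m 0 * (x 1)\<^sup>2 - 2 * m 1 * x 1 + m 2 = 0\<close>, which has two real roots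
  whenever it is solvable with \<open>a 0 1 \<noteq> 0\<close> and \<open>a 1 1 \<noteq> 0\<close>.
\<close>
definition prony_near ::
  "nat \<Rightarrow> (nat \<Rightarrow> nat) \<Rightarrow> real \<Rightarrow> (nat \<Rightarrow> nat \<Rightarrow> real) \<Rightarrow> (nat \<Rightarrow> real)
     \<Rightarrow> (nat \<Rightarrow> nat \<Rightarrow> real) \<Rightarrow> (nat \<Rightarrow> real) \<Rightarrow> bool" where
  "prony_near N l r a x b y \<longleftrightarrow>
     (\<forall>j\<in>{1..N}. \<bar>y j - x j\<bar> < r \<and> (\<forall>i<l j. \<bar>b i j - a i j\<bar> < r))"

end

theory Submission
  imports Defs "Jordan_Normal_Form.Determinant"
begin

text \<open>
  Write \<open>A j = a (l j - 1) j\<close> for the leading coefficient at the node \<open>x j\<close>, and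
  \<open>w i j k = k (k - 1) \<dots> (k - i + 1) (x j)^(k - i)\<close>, the \<open>i\<close>-th derivative of \<open>z^k\<close> at
  \<open>x j\<close>. Differentiating \<open>w i j\<close> in the node yields \<open>w (i + 1) j\<close>, so to first order
  the change of the moments is
  \<open>\<Sum>j. (\<Sum>i<l j. da i j * w i j) + (\<Sum>i<l j. a i j * dx j * w (i + 1) j)\<close>.
  Collecting the coefficient of each \<open>w i j\<close>, \<open>i \<le> l j\<close>, suggests the new unknowns
  \<open>u (j, l j) = A j * dx j\<close>, \<open>u (j, 0) = da 0 j\<close> and
  \<open>u (j, i) = da i j + a (i - 1) j * dx j\<close> for \<open>0 < i < l j\<close>. They are in linear bijection with the old ones because
  \<open>A j \<noteq> 0\<close>, and in them the derivative of the moment map is the confluent Vandermonde matrix with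
  multiplicity \<open>l j + 1\<close> at \<open>x j\<close>. This matrix does not involve the coefficients. It is
  invertible: a polynomial of degree below its size that vanishes to order \<open>l j + 1\<close> at each
  \<open>x j\<close> is zero (\<open>confluent_vandermonde_left_kernel\<close>).

  The moment map is strictly differentiable: on a small box its difference from the Vandermonde matrix
  is Lipschitz with as small a constant as desired (\<open>eventually_moments_almost_linear\<close>). With
  \<open>C\<close> a bound for the inverse matrix in the maximum norm, the simplified Newton iteration contracts
  by the factor \<open>1/2\<close>. Hence the perturbed system has one solution in the box, and this solution
  satisfies \<open>\<bar>u p\<bar> \<le> 2 C \<epsilon>\<close> (locale \<open>almost_linear_system\<close>). Returning to the original
  unknowns by
  \<open>dx j = u (j, l j) / A j\<close> and \<open>da i j = u (j, i) - (a (i - 1) j / A j) u (j, l j)\<close> gives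
  exactly the claimed estimates with \<open>C\<^sub>2 = 2 C\<close> (\<open>shifted_parameter_bounds\<close>). The constant
  \<open>C\<close> comes from the Vandermonde matrix alone; the coefficients decide how small the box of
  uniqueness and \<open>\<epsilon>\<close> have to be.
\<close>

section \<open>Invertibility of the confluent Vandermonde matrix\<close>

text \<open>Each derivative lowers the order of a root by exactly one, in characteristic zero.\<close>
lemma order_ge_if_derivatives_vanish:
  fixes p :: "'a::field_char_0 poly"
  assumes "p \<noteq> 0" and "\<And>i. i < n \<Longrightarrow> poly ((pderiv ^^ i) p) x = 0"
  shows "n \<le> order x p"
  using assms
proof (induction n arbitrary: p)
  case (Suc n)
  have root: "poly p x = 0"
    using Suc.prems(2)[of 0] by simp
  have "pderiv p \<noteq> 0"
    using root Suc.prems(1) by (auto dest!: pderiv_iszero)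
  moreover have "poly ((pderiv ^^ i) (pderiv p)) x = 0" if "i < n" for i
    using Suc.prems(2)[of "Suc i"] that by (simp add: funpow_swap1)
  ultimately have "n \<le> order x (pderiv p)"
    by (rule Suc.IH)
  then show ?case
    using order_pderiv[OF Suc.prems(1) root] by simp
qed simp

lemma sum_order_le_degree:
  fixes p :: "'a::idom poly"
  assumes "p \<noteq> 0" "finite S"
  shows "(\<Sum>z\<in>S. order z p) \<le> degree p"
proof -
  have "(\<Sum>z\<in>S. order z p) = (\<Sum>z\<in>S \<inter> set_mset (proots p). order z p)"
    using assms by (intro sum.mono_neutral_right) (auto simp: order_root)
  also have "\<dots> \<le> (\<Sum>z\<in>set_mset (proots p). order z p)"
    by (intro sum_mono2) auto
  also have "\<dots> = size (proots p)"
    using assms by (simp add: size_multiset_overloaded_eq)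
  also have "\<dots> \<le> degree p"
    by (rule size_proots_le)
  finally show ?thesis .
qed

definition power_deriv :: "nat \<Rightarrow> nat \<Rightarrow> real \<Rightarrow> real" where
  "power_deriv k i z = (\<Prod>t<i. real k - real t) * z ^ (k - i)"

text \<open>
  At \<open>i = k\<close> the truncated exponent \<open>k - i\<close> no longer drops, but from there on the next falling
  factorial contains the factor \<open>k - k\<close>.
\<close>
lemma has_derivative_power_deriv:
  "(power_deriv k i has_real_derivative power_deriv k (Suc i) z) (at z)"
proof (cases "i < k")
  case True
  then have "power_deriv k (Suc i) z =
      (\<Prod>t<i. real k - real t) * (real (k - i) * z ^ (k - i - Suc 0))"
    by (simp add: power_deriv_def)
  then show ?thesis
    unfolding power_deriv_def [abs_def] by (simp only:) (intro DERIV_cmult DERIV_pow)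
next
  case False
  then have "(\<Prod>t<Suc i. real k - real t) = 0"
    by (intro prod_zero) auto
  then have "power_deriv k (Suc i) z = 0"
    by (simp add: power_deriv_def)
  moreover have "power_deriv k i = (\<lambda>z. \<Prod>t<i. real k - real t)"
    using False by (auto simp: power_deriv_def)
  ultimately show ?thesis
    by (simp only: DERIV_const)
qed

lemma poly_higher_pderiv_eq_sum_power_deriv:
  fixes c :: "nat \<Rightarrow> real"
  shows "poly ((pderiv ^^ i) (\<Sum>k<n. monom (c k) k)) z = (\<Sum>k<n. c k * power_deriv k i z)"
proof (induction i arbitrary: z)
  case 0
  then show ?case
    by (simp add: poly_sum poly_monom power_deriv_def)
next
  case (Suc i)
  define q where "q = (pderiv ^^ i) (\<Sum>k<n. monom (c k) k)"
  have "(poly q has_real_derivative poly (pderiv q) z) (at z)"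
    by (rule poly_DERIV)
  moreover have "poly q = (\<lambda>z. \<Sum>k<n. c k * power_deriv k i z)"
    using Suc.IH by (auto simp: q_def)
  moreover have "((\<lambda>z. \<Sum>k<n. c k * power_deriv k i z) has_real_derivative
      (\<Sum>k<n. c k * power_deriv k (Suc i) z)) (at z)"
    by (intro DERIV_sum DERIV_cmult has_derivative_power_deriv)
  ultimately have "poly (pderiv q) z = (\<Sum>k<n. c k * power_deriv k (Suc i) z)"
    by (metis DERIV_unique)
  then show ?case
    by (simp add: q_def)
qed

text \<open>
  A vector in the left kernel is the coefficient sequence of a polynomial with a root of order at least
  \<open>n j\<close> at every \<open>x j\<close>. Its degree is below the sum of these orders, so it is zero.
\<close>
lemma confluent_vandermonde_left_kernel:
  fixes c x :: "nat \<Rightarrow> real"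
  assumes inj: "inj_on x J" and fin: "finite J"
    and kernel: "\<And>j i. j \<in> J \<Longrightarrow> i < n j \<Longrightarrow> (\<Sum>k<sum n J. c k * power_deriv k i (x j)) = 0"
    and k: "k < sum n J"
  shows "c k = 0"
proof -
  define p where "p = (\<Sum>k<sum n J. monom (c k) k)"
  have coeff: "coeff p i = (if i < sum n J then c i else 0)" for i
    by (simp add: p_def coeff_sum)
  have "p = 0"
  proof (rule ccontr)
    assume "p \<noteq> 0"
    have "sum n J \<le> (\<Sum>j\<in>J. order (x j) p)"
      using kernel \<open>p \<noteq> 0\<close>
      by (intro sum_mono order_ge_if_derivatives_vanish)
         (auto simp: p_def poly_higher_pderiv_eq_sum_power_deriv)
    also have "\<dots> = (\<Sum>z\<in>x ` J. order z p)"
      using inj by (simp add: sum.reindex)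
    also have "\<dots> \<le> degree p"
      using fin \<open>p \<noteq> 0\<close> by (intro sum_order_le_degree) auto
    finally have "coeff p (degree p) = 0"
      by (simp add: coeff)
    then show False
      using \<open>p \<noteq> 0\<close> by simp
  qed
  then show ?thesis
    using coeff[of k] k by simp
qed

text \<open>
  The columns are indexed by an arbitrary finite set, since the unknowns of the Prony system are
  naturally indexed by pairs. The inverse is two-sided: being a left inverse gives uniqueness of
  solutions of the nonlinear system, being a right inverse gives their existence.
\<close>
lemma inverse_of_trivial_left_kernel:
  fixes V :: "nat \<Rightarrow> 'i \<Rightarrow> real"
  assumes fin: "finite I" and card: "card I = n"
    and kernel: "\<And>c. \<forall>q\<in>I. (\<Sum>k<n. c k * V k q) = 0 \<Longrightarrow> \<forall>k<n. c k = 0"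
  obtains W :: "'i \<Rightarrow> nat \<Rightarrow> real" where
    "\<And>p q. p \<in> I \<Longrightarrow> q \<in> I \<Longrightarrow> (\<Sum>k<n. W p k * V k q) = (if p = q then 1 else 0)"
    "\<And>k k'. k < n \<Longrightarrow> k' < n \<Longrightarrow> (\<Sum>p\<in>I. V k p * W p k') = (if k = k' then 1 else 0)"
proof -
  obtain e where e: "bij_betw e {0..<n} I"
    using fin card ex_bij_betw_nat_finite by blast
  define f where "f = the_inv_into {0..<n} e"
  have f: "f q < n" "e (f q) = q" if "q \<in> I" for q
    using e that unfolding f_def
    by (metis atLeastLessThan_iff bij_betw_def the_inv_into_into subset_refl)
       (metis e f_def f_the_inv_into_f_bij_betw that)
  have fe: "f (e s) = s" if "s < n" for s
    using e that unfolding f_def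
    by (simp add: bij_betw_def the_inv_into_f_f)
  have sum_e: "(\<Sum>s<n. g (e s)) = (\<Sum>p\<in>I. g p)" for g :: "'i \<Rightarrow> real"
    using sum.reindex_bij_betw[OF e, of g] by (simp add: atLeast0LessThan)
  \<comment> \<open>The matrix is transposed, so that the assumption describes its right kernel.\<close>
  define M where "M = mat n n (\<lambda>(s, k). V k (e s))"
  have M: "M \<in> carrier_mat n n"
    by (simp add: M_def)
  have "det M \<noteq> 0"
  proof
    assume "det M = 0"
    then obtain v where v: "v \<in> carrier_vec n" "v \<noteq> 0\<^sub>v n" "M *\<^sub>v v = 0\<^sub>v n"
      using det_0_iff_vec_prod_zero_field[OF M] by auto
    have "(\<Sum>k<n. v $ k * V k q) = 0" if "q \<in> I" for q
    proof -
      have "(M *\<^sub>v v) $ f q = 0"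
        using v f[OF that] by simp
      then show ?thesis
        using v(1) f[OF that] M
        by (simp add: M_def scalar_prod_def atLeast0LessThan mult.commute)
    qed
    then have "v $ k = 0" if "k < n" for k
      using kernel[of "\<lambda>k. v $ k"] that by blast
    then show False
      using v(1,2) by (auto intro!: eq_vecI)
  qed
  then obtain B where B: "B \<in> carrier_mat n n" "M * B = 1\<^sub>m n" "B * M = 1\<^sub>m n"
    using det_non_zero_imp_unit[OF M, of "()"]
    unfolding Units_def ring_mat_def by auto
  have MB: "(\<Sum>k<n. V k (e s) * B $$ (k, t)) = (if s = t then 1 else 0)" if "s < n" "t < n" for s t
  proof -
    have "(M * B) $$ (s, t) = (if s = t then 1 else 0)"
      using B that by simp
    then show ?thesis
      using B(1) M that by (simp add: M_def scalar_prod_def atLeast0LessThan)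
  qed
  have BM: "(\<Sum>s<n. B $$ (k', s) * V k (e s)) = (if k' = k then 1 else 0)" if "k < n" "k' < n" for k k'
  proof -
    have "(B * M) $$ (k', k) = (if k' = k then 1 else 0)"
      using B that by simp
    then show ?thesis
      using B(1) M that by (simp add: M_def scalar_prod_def atLeast0LessThan)
  qed
  show thesis
  proof (rule that[of "\<lambda>p k. B $$ (k, f p)"])
    fix p q assume pq: "p \<in> I" "q \<in> I"
    have "(\<Sum>k<n. B $$ (k, f p) * V k q) = (if f q = f p then 1 else 0)"
      using MB[of "f q" "f p"] f pq by (simp add: mult.commute)
    moreover have "f q = f p \<longleftrightarrow> p = q"
      using f pq by metis
    ultimately show "(\<Sum>k<n. B $$ (k, f p) * V k q) = (if p = q then 1 else 0)"
      by simp
  next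
    fix k k' assume "k < n" "k' < n"
    then show "(\<Sum>p\<in>I. V k p * B $$ (k', f p)) = (if k = k' then 1 else 0)"
      using BM[of k k'] sum_e[of "\<lambda>p. V k p * B $$ (k', f p)"] fe
      by (auto simp: mult.commute)
  qed
qed

section \<open>Solving almost linear systems by contraction\<close>

text \<open>
  Banach's theorem in the maximum norm over the finite index set \<open>I\<close>. The norm is
  expressed by uniform bounds \<open>d\<close> on the coordinates in \<open>I\<close>, so that \<open>u\<close> can range over
  total functions instead of a space of functions on \<open>I\<close>.
\<close>
lemma contraction_fixpoint_exists:
  fixes T :: "('i \<Rightarrow> real) \<Rightarrow> 'i \<Rightarrow> real"
  assumes fin: "finite I" and r: "0 \<le> r"
    and self: "\<And>u p. \<forall>q\<in>I. \<bar>u q\<bar> \<le> r \<Longrightarrow> p \<in> I \<Longrightarrow> \<bar>T u p\<bar> \<le> r"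
    and contr: "\<And>u v d p. \<forall>q\<in>I. \<bar>u q\<bar> \<le> r \<Longrightarrow> \<forall>q\<in>I. \<bar>v q\<bar> \<le> r \<Longrightarrow>
      \<forall>q\<in>I. \<bar>u q - v q\<bar> \<le> d \<Longrightarrow> p \<in> I \<Longrightarrow> \<bar>T u p - T v p\<bar> \<le> d / 2"
  shows "\<exists>u. \<forall>p\<in>I. \<bar>u p\<bar> \<le> r \<and> T u p = u p"
proof -
  define z where "z n = (T ^^ n) (\<lambda>_. 0)" for n
  have z_Suc: "z (Suc n) = T (z n)" for n
    by (simp add: z_def)
  have bound: "\<bar>z n p\<bar> \<le> r" if "p \<in> I" for n p
    using that
  proof (induction n arbitrary: p)
    case 0
    then show ?case using r by (simp add: z_def)
  next
    case (Suc n)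
    then show ?case unfolding z_Suc by (intro self ballI)
  qed
  have step: "\<bar>z (Suc n) p - z n p\<bar> \<le> r * (1 / 2) ^ n" if "p \<in> I" for n p
    using that
  proof (induction n arbitrary: p)
    case 0
    then show ?case using bound[of p 1] by (simp add: z_def)
  next
    case (Suc n)
    have "\<bar>T (z (Suc n)) p - T (z n) p\<bar> \<le> r * (1 / 2) ^ n / 2"
      using Suc by (intro contr ballI bound)
    then show ?case by (simp add: z_Suc)
  qed
  define u where "u p = lim (\<lambda>n. z n p)" for p
  have lim: "(\<lambda>n. z n p) \<longlonglongrightarrow> u p" if "p \<in> I" for p
  proof -
    have "summable (\<lambda>n. z (Suc n) p - z n p)"
    proof (rule summable_comparison_test)
      show "\<exists>m. \<forall>n\<ge>m. norm (z (Suc n) p - z n p) \<le> r * (1 / 2) ^ n"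
        using step[OF that] by auto
      show "summable (\<lambda>n. r * (1 / 2 :: real) ^ n)"
        by (intro summable_mult summable_geometric) auto
    qed
    then have "convergent (\<lambda>n. \<Sum>k<n. z (Suc k) p - z k p)"
      by (simp add: summable_iff_convergent)
    moreover have "(\<Sum>k<n. z (Suc k) p - z k p) = z n p - z 0 p" for n
      by (rule sum_lessThan_telescope)
    ultimately have "convergent (\<lambda>n. z n p - z 0 p)"
      by simp
    then have "convergent (\<lambda>n. z n p)"
      by (simp add: z_def convergent_diff_const_right_iff)
    then show ?thesis
      by (simp add: u_def convergent_LIMSEQ_iff)
  qed
  have u_bound: "\<bar>u p\<bar> \<le> r" if "p \<in> I" for p
    using tendsto_rabs[OF lim[OF that]] bound[OF that]
    by (intro LIMSEQ_le_const2[of "\<lambda>n. \<bar>z n p\<bar>"]) auto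
  have "T u p = u p" if p: "p \<in> I" for p
  proof (rule LIMSEQ_unique)
    show "(\<lambda>n. T (z n) p) \<longlonglongrightarrow> u p"
      using LIMSEQ_Suc[OF lim[OF p]] by (simp add: z_Suc)
    show "(\<lambda>n. T (z n) p) \<longlonglongrightarrow> T u p"
    proof (rule LIMSEQ_I)
      fix e :: real assume "e > 0"
      have "\<forall>\<^sub>F n in sequentially. \<forall>q\<in>I. \<bar>z n q - u q\<bar> < e"
        using fin
      proof (rule eventually_ball_finite)
        show "\<forall>q\<in>I. \<forall>\<^sub>F n in sequentially. \<bar>z n q - u q\<bar> < e"
          using lim \<open>e > 0\<close> by (auto simp: tendsto_iff dist_real_def)
      qed
      then obtain n0 where n0: "\<And>n q. n \<ge> n0 \<Longrightarrow> q \<in> I \<Longrightarrow> \<bar>z n q - u q\<bar> \<le> e"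
        by (force simp: eventually_sequentially)
      have "\<bar>T (z n) p - T u p\<bar> \<le> e / 2" if "n \<ge> n0" for n
        using p n0[OF that] by (intro contr ballI bound u_bound)
      then show "\<exists>n0. \<forall>n\<ge>n0. norm (T (z n) p - T u p) < e"
        using \<open>e > 0\<close> by (intro exI[of _ n0]) force
    qed
  qed
  with u_bound show ?thesis
    by blast
qed

text \<open>
  \<open>G\<close> differs from the invertible matrix \<open>V\<close> by a map which is Lipschitz with constant \<open>e\<close> on
  the box of radius \<open>r\<close>. Since \<open>C\<close> bounds the inverse \<open>W\<close>, the condition
  \<open>C * e \<le> 1 / 2\<close> makes \<open>u - W (G u - y)\<close> a contraction with factor \<open>1 / 2\<close>.
\<close>
locale almost_linear_system =
  fixes I :: "'i set" and n :: nat
    and V :: "nat \<Rightarrow> 'i \<Rightarrow> real" and W :: "'i \<Rightarrow> nat \<Rightarrow> real"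
    and G :: "('i \<Rightarrow> real) \<Rightarrow> nat \<Rightarrow> real"
    and C e r :: real
  assumes fin: "finite I"
    and left_inverse: "\<And>p q. p \<in> I \<Longrightarrow> q \<in> I \<Longrightarrow> (\<Sum>k<n. W p k * V k q) = (if p = q then 1 else 0)"
    and right_inverse: "\<And>k k'. k < n \<Longrightarrow> k' < n \<Longrightarrow>
      (\<Sum>p\<in>I. V k p * W p k') = (if k = k' then 1 else 0)"
    and row_sum: "\<And>p. p \<in> I \<Longrightarrow> (\<Sum>k<n. \<bar>W p k\<bar>) \<le> C"
    and small: "0 \<le> e" "C * e \<le> 1 / 2"
    and almost_linear: "\<And>u v d k. \<forall>q\<in>I. \<bar>u q\<bar> \<le> r \<Longrightarrow> \<forall>q\<in>I. \<bar>v q\<bar> \<le> r \<Longrightarrow>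
      \<forall>q\<in>I. \<bar>u q - v q\<bar> \<le> d \<Longrightarrow> k < n \<Longrightarrow>
      \<bar>G u k - G v k - (\<Sum>p\<in>I. V k p * (u p - v p))\<bar> \<le> e * d"
begin

lemma abs_W_sum_le:
  assumes "p \<in> I" "0 \<le> b" "\<And>k. k < n \<Longrightarrow> \<bar>g k\<bar> \<le> b"
  shows "\<bar>\<Sum>k<n. W p k * g k\<bar> \<le> C * b"
proof -
  have "\<bar>\<Sum>k<n. W p k * g k\<bar> \<le> (\<Sum>k<n. \<bar>W p k\<bar> * b)"
    using assms by (intro order.trans[OF sum_abs] sum_mono) (auto simp: abs_mult mult_left_mono)
  also have "\<dots> \<le> C * b"
    using row_sum[of p] assms by (auto simp flip: sum_distrib_right intro: mult_right_mono)
  finally show ?thesis .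
qed

lemma W_V_cancel:
  assumes "p \<in> I"
  shows "(\<Sum>k<n. W p k * (\<Sum>q\<in>I. V k q * h q)) = h p"
proof -
  have "(\<Sum>k<n. W p k * (\<Sum>q\<in>I. V k q * h q)) = (\<Sum>q\<in>I. (\<Sum>k<n. W p k * V k q) * h q)"
    by (simp add: sum_distrib_left sum_distrib_right mult.assoc sum.swap[of _ _ I])
  also have "\<dots> = (\<Sum>q\<in>I. if p = q then h q else 0)"
    using assms by (intro sum.cong) (auto simp: left_inverse)
  also have "\<dots> = h p"
    using assms fin by simp
  finally show ?thesis .
qed

lemma V_W_cancel:
  assumes "k < n"
  shows "(\<Sum>p\<in>I. V k p * (\<Sum>k'<n. W p k' * g k')) = g k"
proof -
  have "(\<Sum>p\<in>I. V k p * (\<Sum>k'<n. W p k' * g k')) = (\<Sum>k'<n. (\<Sum>p\<in>I. V k p * W p k') * g k')"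
    by (simp add: sum_distrib_left sum_distrib_right mult.assoc sum.swap[of _ I])
  also have "\<dots> = (\<Sum>k'<n. if k = k' then g k' else 0)"
    using assms by (intro sum.cong) (auto simp: right_inverse)
  also have "\<dots> = g k"
    using assms by simp
  finally show ?thesis .
qed

text \<open>
  Because \<open>W V\<close> is the identity, the linear part of \<open>G\<close> cancels in the Newton step and only
  the nonlinear remainder is left.
\<close>
lemma newton_step_contracts:
  assumes "\<forall>q\<in>I. \<bar>u q\<bar> \<le> r" "\<forall>q\<in>I. \<bar>v q\<bar> \<le> r"
    and d: "\<forall>q\<in>I. \<bar>u q - v q\<bar> \<le> d" and p: "p \<in> I"
  shows "\<bar>(u p - (\<Sum>k<n. W p k * (G u k - y k))) - (v p - (\<Sum>k<n. W p k * (G v k - y k)))\<bar> \<le> d / 2"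
proof -
  have "d \<ge> 0"
    using d p by force
  have "(u p - (\<Sum>k<n. W p k * (G u k - y k))) - (v p - (\<Sum>k<n. W p k * (G v k - y k)))
      = - (\<Sum>k<n. W p k * (G u k - G v k - (\<Sum>q\<in>I. V k q * (u q - v q))))"
    using W_V_cancel[OF p, of "\<lambda>q. u q - v q"]
    by (simp add: algebra_simps sum.distrib sum_subtractf)
  also have "\<bar>\<dots>\<bar> \<le> C * (e * d)"
    unfolding abs_minus_cancel
    using assms small \<open>d \<ge> 0\<close> by (intro abs_W_sum_le almost_linear) auto
  also have "\<dots> \<le> d / 2"
    using mult_right_mono[OF small(2) \<open>d \<ge> 0\<close>] by simp
  finally show ?thesis .
qed

lemma solution_unique:
  assumes u: "\<forall>q\<in>I. \<bar>u q\<bar> \<le> r" and v: "\<forall>q\<in>I. \<bar>v q\<bar> \<le> r"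
    and eq: "\<And>k. k < n \<Longrightarrow> G u k = G v k" and p: "p \<in> I"
  shows "u p = v p"
proof -
  \<comment> \<open>The largest distance is at most half of itself.\<close>
  define d where "d = Max ((\<lambda>q. \<bar>u q - v q\<bar>) ` I)"
  have d: "\<forall>q\<in>I. \<bar>u q - v q\<bar> \<le> d"
    using fin by (auto simp: d_def)
  have "\<bar>u q - v q\<bar> \<le> d / 2" if "q \<in> I" for q
    using newton_step_contracts[OF u v d that, where y = "G v"] eq by simp
  moreover have "d \<in> (\<lambda>q. \<bar>u q - v q\<bar>) ` I"
    using fin p unfolding d_def by (intro Max_in) auto
  ultimately have "d \<le> d / 2"
    by blast
  then have "d \<le> 0"
    by simp
  with d p show ?thesis
    by force
qed

text \<open>
  The Newton step with fixed derivative moves the origin by at most \<open>C * \<epsilon>\<close>. As a contraction with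
  factor \<open>1 / 2\<close> it therefore maps the box of radius
  \<open>2 * C * \<epsilon>\<close> to itself.
\<close>
lemma solution_exists:
  assumes y: "\<And>k. k < n \<Longrightarrow> \<bar>G (\<lambda>_. 0) k - y k\<bar> \<le> \<epsilon>"
    and \<epsilon>: "0 \<le> \<epsilon>" "0 \<le> C" "2 * C * \<epsilon> \<le> r"
  obtains u where "\<And>p. p \<in> I \<Longrightarrow> \<bar>u p\<bar> \<le> 2 * C * \<epsilon>" "\<And>k. k < n \<Longrightarrow> G u k = y k"
proof -
  define T where "T u p = u p - (\<Sum>k<n. W p k * (G u k - y k))" for u p
  have small_r: "\<bar>w q\<bar> \<le> r" if "\<bar>w q\<bar> \<le> 2 * C * \<epsilon>" for w :: "'i \<Rightarrow> real" and q
    using that \<epsilon> by linarith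
  have contr: "\<bar>T u p - T v p\<bar> \<le> d / 2"
    if "\<forall>q\<in>I. \<bar>u q\<bar> \<le> 2 * C * \<epsilon>" "\<forall>q\<in>I. \<bar>v q\<bar> \<le> 2 * C * \<epsilon>"
      "\<forall>q\<in>I. \<bar>u q - v q\<bar> \<le> d" "p \<in> I" for u v d p
    unfolding T_def using that small_r by (intro newton_step_contracts) auto
  have self: "\<bar>T u p\<bar> \<le> 2 * C * \<epsilon>"
    if u: "\<forall>q\<in>I. \<bar>u q\<bar> \<le> 2 * C * \<epsilon>" and p: "p \<in> I" for u p
  proof -
    have "\<bar>T u p - T (\<lambda>_. 0) p\<bar> \<le> 2 * C * \<epsilon> / 2"
      using u p \<epsilon> by (intro contr) auto
    moreover have "\<bar>T (\<lambda>_. 0) p\<bar> \<le> C * \<epsilon>"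
      unfolding T_def using abs_W_sum_le[OF p \<epsilon>(1), of "\<lambda>k. G (\<lambda>_. 0) k - y k"] y by simp
    ultimately show ?thesis
      by linarith
  qed
  have "\<exists>u. \<forall>p\<in>I. \<bar>u p\<bar> \<le> 2 * C * \<epsilon> \<and> T u p = u p"
    using \<epsilon> by (intro contraction_fixpoint_exists fin self contr) auto
  then obtain u where u: "\<And>p. p \<in> I \<Longrightarrow> \<bar>u p\<bar> \<le> 2 * C * \<epsilon>" "\<And>p. p \<in> I \<Longrightarrow> T u p = u p"
    by blast
  have "G u k = y k" if "k < n" for k
  proof -
    have "(\<Sum>k'<n. W p k' * (G u k' - y k')) = 0" if "p \<in> I" for p
      using u(2)[OF that] by (simp add: T_def)
    then have "(\<Sum>p\<in>I. V k p * (\<Sum>k'<n. W p k' * (G u k' - y k'))) = 0"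
      by simp
    then show ?thesis
      using V_W_cancel[OF that, of "\<lambda>k. G u k - y k"] by simp
  qed
  with u(1) show thesis
    by (rule that)
qed

end

section \<open>The moment map in adapted coordinates\<close>

lemma increment_eq_derivative_times_step:
  fixes f f' :: "real \<Rightarrow> real"
  assumes deriv: "\<And>z. (f has_real_derivative f' z) (at z)"
  obtains \<xi> where "min a b \<le> \<xi>" "\<xi> \<le> max a b" "f b - f a = (b - a) * f' \<xi>"
proof (cases a b rule: linorder_cases)
  case less
  then obtain \<xi> where "a < \<xi>" "\<xi> < b" "f b - f a = (b - a) * f' \<xi>"
    using MVT2[of a b f f'] deriv by blast
  then show thesis
    using less by (intro that[of \<xi>]) auto
next
  case equal
  then show thesis
    by (intro that[of a]) auto
next
  case greater
  then obtain \<xi> where "b < \<xi>" "\<xi> < a" "f a - f b = (a - b) * f' \<xi>"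
    using MVT2[of b a f f'] deriv by blast
  then show thesis
    using greater by (intro that[of \<xi>]) (auto simp: algebra_simps)
qed

text \<open>
  Strict differentiability of \<open>(a + s) * f (x + t)\<close> in \<open>(s, t)\<close> at the origin. Mere
  differentiability would compare with the origin only, whereas a contraction needs
  the comparison of two arbitrary nearby points.
\<close>
lemma eventually_scaled_function_almost_linear:
  fixes f f' :: "real \<Rightarrow> real"
  assumes deriv: "\<And>z. (f has_real_derivative f' z) (at z)" and cont: "isCont f' x" and "e > 0"
  shows "\<forall>\<^sub>F r in at_right 0. \<forall>s s' t t'. \<bar>s\<bar> \<le> r \<and> \<bar>s'\<bar> \<le> r \<and> \<bar>t\<bar> \<le> r \<and> \<bar>t'\<bar> \<le> r \<longrightarrow>
    \<bar>(a + s) * f (x + t) - (a + s') * f (x + t') - (f x * (s - s') + a * f' x * (t - t'))\<bar>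
      \<le> e * (\<bar>s - s'\<bar> + \<bar>t - t'\<bar>)"
proof -
  have "isCont f x"
    using deriv by (rule DERIV_isCont)
  have "((\<lambda>z. f z) \<longlongrightarrow> f x) (nhds x)"
    using \<open>isCont f x\<close> by (simp add: isCont_def tendsto_nhds_iff)
  then obtain r1 where r1: "r1 > 0" "\<And>z. \<bar>z - x\<bar> < r1 \<Longrightarrow> \<bar>f z - f x\<bar> < e"
    using \<open>e > 0\<close> unfolding tendsto_iff eventually_nhds_metric dist_real_def by metis
  \<comment> \<open>The slope in \<open>t\<close> changes by \<open>a * (f' \<xi> - f' x) + s' * f' \<xi>\<close>; each summand gets the
    share \<open>e / 2\<close>, and \<open>\<eta> \<le> 1\<close> keeps \<open>\<bar>f' \<xi>\<bar>\<close> below \<open>\<bar>f' x\<bar> + 1\<close>.\<close>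
  define \<eta> where "\<eta> = min 1 (e / (2 * (\<bar>a\<bar> + 1)))"
  have \<eta>: "\<eta> > 0" "\<eta> \<le> 1" "\<bar>a\<bar> * \<eta> \<le> e / 2"
  proof -
    show "\<eta> > 0" "\<eta> \<le> 1"
      using \<open>e > 0\<close> by (auto simp: \<eta>_def)
    have "\<bar>a\<bar> * \<eta> \<le> (\<bar>a\<bar> + 1) * (e / (2 * (\<bar>a\<bar> + 1)))"
      using \<open>\<eta> > 0\<close> by (intro mult_mono) (auto simp: \<eta>_def)
    also have "\<dots> = e / 2"
      using add_pos_pos[of "\<bar>a\<bar> + 1" 1] abs_ge_zero[of a] by (simp add: divide_simps)
    finally show "\<bar>a\<bar> * \<eta> \<le> e / 2" .
  qed
  have "((\<lambda>z. f' z) \<longlongrightarrow> f' x) (nhds x)"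
    using cont by (simp add: isCont_def tendsto_nhds_iff)
  then obtain r2 where r2: "r2 > 0" "\<And>z. \<bar>z - x\<bar> < r2 \<Longrightarrow> \<bar>f' z - f' x\<bar> < \<eta>"
    using \<open>\<eta> > 0\<close> unfolding tendsto_iff eventually_nhds_metric dist_real_def by metis
  define r3 where "r3 = e / (2 * (\<bar>f' x\<bar> + 1))"
  have r3: "r3 > 0" "r3 * (\<bar>f' x\<bar> + 1) = e / 2"
    using \<open>e > 0\<close> by (auto simp: r3_def field_simps)
  have main: "\<bar>(a + s) * f (x + t) - (a + s') * f (x + t') - (f x * (s - s') + a * f' x * (t - t'))\<bar>
      \<le> e * (\<bar>s - s'\<bar> + \<bar>t - t'\<bar>)"
    if r: "r < r1" "r < r2" "r \<le> r3"
      and st: "\<bar>s\<bar> \<le> r" "\<bar>s'\<bar> \<le> r" "\<bar>t\<bar> \<le> r" "\<bar>t'\<bar> \<le> r" for r s s' t t'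
  proof -
    obtain \<xi> where \<xi>: "min (x + t') (x + t) \<le> \<xi>" "\<xi> \<le> max (x + t') (x + t)"
      "f (x + t) - f (x + t') = (x + t - (x + t')) * f' \<xi>"
      using increment_eq_derivative_times_step[OF deriv] by metis
    have f'\<xi>: "\<bar>f' \<xi> - f' x\<bar> < \<eta>"
      using \<xi>(1,2) r st by (intro r2(2)) (auto simp: min_def max_def abs_le_iff split: if_splits)
    have ft: "\<bar>f (x + t) - f x\<bar> \<le> e"
      using r1(2)[of "x + t"] r st by auto
    have "\<bar>(a + s') * f' \<xi> - a * f' x\<bar> = \<bar>a * (f' \<xi> - f' x) + s' * f' \<xi>\<bar>"
      by (simp add: algebra_simps)
    also have "\<dots> \<le> \<bar>a\<bar> * \<bar>f' \<xi> - f' x\<bar> + \<bar>s'\<bar> * \<bar>f' \<xi>\<bar>"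
      by (metis abs_mult abs_triangle_ineq)
    also have "\<dots> \<le> \<bar>a\<bar> * \<eta> + r3 * (\<bar>f' x\<bar> + 1)"
      using f'\<xi> st r r3 \<eta> by (intro add_mono mult_mono) auto
    also have "\<dots> \<le> e"
      using \<eta> r3 by simp
    finally have slope: "\<bar>(a + s') * f' \<xi> - a * f' x\<bar> \<le> e" .
    have "(a + s) * f (x + t) - (a + s') * f (x + t') - (f x * (s - s') + a * f' x * (t - t'))
        = (f (x + t) - f x) * (s - s') + (a + s') * (f (x + t) - f (x + t')) - a * f' x * (t - t')"
      by (simp add: algebra_simps)
    also have "\<dots> = (f (x + t) - f x) * (s - s') + ((a + s') * f' \<xi> - a * f' x) * (t - t')"
      unfolding \<xi>(3) by (simp add: algebra_simps)
    also have "\<bar>\<dots>\<bar> \<le> \<bar>f (x + t) - f x\<bar> * \<bar>s - s'\<bar> + \<bar>(a + s') * f' \<xi> - a * f' x\<bar> * \<bar>t - t'\<bar>"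
      by (metis abs_mult abs_triangle_ineq)
    also have "\<dots> \<le> e * \<bar>s - s'\<bar> + e * \<bar>t - t'\<bar>"
      using ft slope by (intro add_mono mult_right_mono) auto
    finally show ?thesis
      by (simp add: algebra_simps)
  qed
  have "\<forall>\<^sub>F r in at_right 0. r < r1 \<and> r < r2 \<and> r < r3"
    using r1(1) r2(1) r3(1) by (auto simp: eventually_conj_iff eventually_at_right_less intro!: eventually_conj order_tendstoD)
  then show ?thesis
    by eventually_elim (auto intro!: main)
qed

text \<open>
  The pair \<open>(j, i)\<close> with \<open>i < l j\<close> belongs to the coefficient \<open>a i j\<close>, and \<open>(j, l j)\<close>
  belongs to the node \<open>x j\<close>.
\<close>
definition prony_index :: "nat \<Rightarrow> (nat \<Rightarrow> nat) \<Rightarrow> (nat \<times> nat) set" where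
  "prony_index N l = (SIGMA j:{1..N}. {..l j})"

lemma card_prony_index: "card (prony_index N l) = prony_size N l"
  by (simp add: prony_index_def prony_size_def sum_Suc)

text \<open>
  The new unknowns \<open>u\<close> are the coefficients of the first order change of the moments in the
  columns of the confluent Vandermonde matrix. The two functions
  \<open>shifted_node\<close> and \<open>shifted_coeff\<close> recover the perturbed nodes and coefficients
  from \<open>u\<close>. The correction by \<open>prev_ratio\<close> compensates what moving the node adds to the \<open>i\<close>-th
  column; nothing is added for \<open>i = 0\<close>.
\<close>
definition shifted_node ::
  "(nat \<Rightarrow> nat) \<Rightarrow> (nat \<Rightarrow> nat \<Rightarrow> real) \<Rightarrow> (nat \<Rightarrow> real) \<Rightarrow> (nat \<times> nat \<Rightarrow> real) \<Rightarrow> nat \<Rightarrow> real" where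
  "shifted_node l a x u j = x j + u (j, l j) / a (l j - 1) j"

definition prev_ratio :: "(nat \<Rightarrow> nat) \<Rightarrow> (nat \<Rightarrow> nat \<Rightarrow> real) \<Rightarrow> nat \<Rightarrow> nat \<Rightarrow> real" where
  "prev_ratio l a i j = (if i = 0 then 0 else a (i - 1) j / a (l j - 1) j)"

definition shifted_coeff ::
  "(nat \<Rightarrow> nat) \<Rightarrow> (nat \<Rightarrow> nat \<Rightarrow> real) \<Rightarrow> (nat \<times> nat \<Rightarrow> real) \<Rightarrow> nat \<Rightarrow> nat \<Rightarrow> real" where
  "shifted_coeff l a u i j = a i j + (u (j, i) - prev_ratio l a i j * u (j, l j))"

lemma prony_moment_eq_power_deriv:
  "prony_moment N l a x k = (\<Sum>j=1..N. \<Sum>i<l j. a i j * power_deriv k i (x j))"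
  by (simp add: prony_moment_def power_deriv_def mult.assoc)

text \<open>
  The contributions \<open>a (i - 1) j * w i\<close> of the moving node cancel against the corrections by
  \<open>prev_ratio\<close>, except for \<open>i = l j\<close>, where no coefficient is left to correct; there the
  leading coefficient cancels against the scaling of the node.
\<close>
lemma block_linearization:
  fixes w :: "nat \<Rightarrow> real"
  assumes "l j \<ge> 1" "a (l j - 1) j \<noteq> 0"
  shows "(\<Sum>i<l j. w i * (u (j, i) - prev_ratio l a i j * u (j, l j))
            + a i j * w (Suc i) * (u (j, l j) / a (l j - 1) j)) = (\<Sum>i\<le>l j. w i * u (j, i))"
proof -
  obtain n where n: "l j = Suc n"
    using assms(1) by (cases "l j") auto
  define h where "h = u (j, l j) / a n j"
  have h: "a n j * h = u (j, l j)"
    using assms n by (simp add: h_def)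
  have "(\<Sum>i<l j. w i * (prev_ratio l a i j * u (j, l j))) = (\<Sum>i<n. a i j * w (Suc i) * h)"
    unfolding n sum.lessThan_Suc_shift
    by (simp add: prev_ratio_def n h_def algebra_simps)
  moreover have "(\<Sum>i<l j. a i j * w (Suc i) * h) = (\<Sum>i<n. a i j * w (Suc i) * h) + w (l j) * u (j, l j)"
    unfolding n sum.lessThan_Suc using h by (simp add: n algebra_simps)
  moreover have "(\<Sum>i\<le>l j. w i * u (j, i)) = (\<Sum>i<l j. w i * u (j, i)) + w (l j) * u (j, l j)"
    by (simp add: lessThan_Suc_atMost [symmetric])
  moreover have "(\<Sum>i<l j. w i * (u (j, i) - prev_ratio l a i j * u (j, l j))
        + a i j * w (Suc i) * h)
      = (\<Sum>i<l j. w i * u (j, i)) - (\<Sum>i<l j. w i * (prev_ratio l a i j * u (j, l j)))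
        + (\<Sum>i<l j. a i j * w (Suc i) * h)"
    by (simp only: right_diff_distrib sum.distrib sum_subtractf)
  moreover have "u (j, l j) / a (l j - 1) j = h"
    by (simp add: h_def n)
  ultimately show ?thesis
    by simp
qed

text \<open>
  The increments of a coefficient and its node are linear in \<open>u\<close>, so their sizes are together at most a
  constant \<open>K\<close> times that of \<open>u\<close>. Hence the estimate in \<open>(s, t)\<close> carries over
  with \<open>e / K\<close> in place of \<open>e\<close> and \<open>K * r\<close> in place of \<open>r\<close>.
\<close>
lemma eventually_term_almost_linear:
  assumes "e > 0" and j: "j \<in> {1..N}" and i: "i < l j" and "a (l j - 1) j \<noteq> 0"
  shows "\<forall>\<^sub>F r in at_right 0. \<forall>u v d.
    (\<forall>q\<in>prony_index N l. \<bar>u q\<bar> \<le> r \<and> \<bar>v q\<bar> \<le> r \<and> \<bar>u q - v q\<bar> \<le> d) \<longrightarrow>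
    \<bar>shifted_coeff l a u i j * power_deriv k i (shifted_node l a x u j)
      - shifted_coeff l a v i j * power_deriv k i (shifted_node l a x v j)
      - (power_deriv k i (x j) * (u (j, i) - v (j, i) - prev_ratio l a i j * (u (j, l j) - v (j, l j)))
         + a i j * power_deriv k (Suc i) (x j) * ((u (j, l j) - v (j, l j)) / a (l j - 1) j))\<bar> \<le> e * d"
proof -
  define A where "A = a (l j - 1) j"
  define c where "c = prev_ratio l a i j"
  define K where "K = 1 + \<bar>c\<bar> + 1 / \<bar>A\<bar>"
  have A: "A \<noteq> 0" and K: "K \<ge> 1"
    using assms by (auto simp: A_def K_def)
  have s_le: "\<bar>h (j, i) - c * h (j, l j)\<bar> + \<bar>h (j, l j) / A\<bar> \<le> K * r"
    if "\<forall>q\<in>prony_index N l. \<bar>h q\<bar> \<le> r" for h :: "nat \<times> nat \<Rightarrow> real" and r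
  proof -
    have "\<bar>h (j, i)\<bar> \<le> r" and l: "\<bar>h (j, l j)\<bar> \<le> r"
      using that i j by (auto simp: prony_index_def)
    moreover have "\<bar>c * h (j, l j)\<bar> \<le> \<bar>c\<bar> * r" "\<bar>h (j, l j) / A\<bar> \<le> 1 / \<bar>A\<bar> * r"
      using l by (auto simp: abs_mult mult_left_mono divide_right_mono)
    moreover have "\<bar>h (j, i) - c * h (j, l j)\<bar> \<le> \<bar>h (j, i)\<bar> + \<bar>c * h (j, l j)\<bar>"
      by (rule abs_triangle_ineq4)
    ultimately show ?thesis
      unfolding K_def distrib_right by linarith
  qed
  have cont: "isCont (power_deriv k (Suc i)) (x j)"
    by (rule DERIV_isCont[OF has_derivative_power_deriv])
  have "\<forall>\<^sub>F r in at_right 0. \<forall>s s' t t'. \<bar>s\<bar> \<le> r \<and> \<bar>s'\<bar> \<le> r \<and> \<bar>t\<bar> \<le> r \<and> \<bar>t'\<bar> \<le> r \<longrightarrow>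
    \<bar>(a i j + s) * power_deriv k i (x j + t) - (a i j + s') * power_deriv k i (x j + t')
      - (power_deriv k i (x j) * (s - s') + a i j * power_deriv k (Suc i) (x j) * (t - t'))\<bar>
      \<le> e / K * (\<bar>s - s'\<bar> + \<bar>t - t'\<bar>)" (is "\<forall>\<^sub>F r in at_right 0. ?P r")
    using \<open>e > 0\<close> K
    by (intro eventually_scaled_function_almost_linear has_derivative_power_deriv cont) auto
  moreover have "filterlim (\<lambda>r. K * r) (at_right 0) (at_right 0)"
    using K by (auto intro!: tendsto_eq_intros filterlim_at_withinI simp: filterlim_at
        eventually_at_right_less eventually_at_filter zero_less_mult_iff)
  ultimately have "\<forall>\<^sub>F r in at_right 0. ?P (K * r)"
    by (rule eventually_compose_filterlim)
  then show ?thesis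
  proof eventually_elim
    case (elim r)
    show ?case
    proof (intro allI impI)
      fix u v :: "nat \<times> nat \<Rightarrow> real" and d
      assume *: "\<forall>q\<in>prony_index N l. \<bar>u q\<bar> \<le> r \<and> \<bar>v q\<bar> \<le> r \<and> \<bar>u q - v q\<bar> \<le> d"
      define su tu where "su = u (j, i) - c * u (j, l j)" and "tu = u (j, l j) / A"
      define sv tv where "sv = v (j, i) - c * v (j, l j)" and "tv = v (j, l j) / A"
      have u: "\<bar>su\<bar> + \<bar>tu\<bar> \<le> K * r" and v: "\<bar>sv\<bar> + \<bar>tv\<bar> \<le> K * r"
        using * s_le[of u r] s_le[of v r] by (auto simp: su_def tu_def sv_def tv_def)
      have diff: "su - sv = u (j, i) - v (j, i) - c * (u (j, l j) - v (j, l j))"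
        "tu - tv = (u (j, l j) - v (j, l j)) / A"
        by (auto simp: su_def tu_def sv_def tv_def algebra_simps diff_divide_distrib)
      have uv: "\<bar>su - sv\<bar> + \<bar>tu - tv\<bar> \<le> K * d"
        using * s_le[of "\<lambda>q. u q - v q" d] by (auto simp: diff)
      have "\<bar>(a i j + su) * power_deriv k i (x j + tu) - (a i j + sv) * power_deriv k i (x j + tv)
          - (power_deriv k i (x j) * (su - sv) + a i j * power_deriv k (Suc i) (x j) * (tu - tv))\<bar>
          \<le> e / K * (\<bar>su - sv\<bar> + \<bar>tu - tv\<bar>)"
        using u v by (intro elim[rule_format]) auto
      also have "\<dots> \<le> e / K * (K * d)"
        using uv \<open>e > 0\<close> K by (intro mult_left_mono) auto
      also have "\<dots> = e * d"
        using K by simp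
      finally show "\<bar>shifted_coeff l a u i j * power_deriv k i (shifted_node l a x u j)
        - shifted_coeff l a v i j * power_deriv k i (shifted_node l a x v j)
        - (power_deriv k i (x j) * (u (j, i) - v (j, i) - prev_ratio l a i j * (u (j, l j) - v (j, l j)))
         + a i j * power_deriv k (Suc i) (x j) * ((u (j, l j) - v (j, l j)) / a (l j - 1) j))\<bar> \<le> e * d"
        unfolding diff unfolding su_def sv_def tu_def tv_def A_def c_def shifted_coeff_def shifted_node_def .
    qed
  qed
qed

text \<open>
  The linear part is the confluent Vandermonde matrix with multiplicities \<open>l j + 1\<close>. The
  coefficients \<open>a\<close> have disappeared from it, which is why the final constant is independent of them.
\<close>
lemma eventually_moments_almost_linear:
  assumes "N \<ge> 1" and "e > 0" and l: "\<forall>j\<in>{1..N}. l j \<ge> 1" and a: "\<forall>j\<in>{1..N}. a (l j - 1) j \<noteq> 0"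
  shows "\<forall>\<^sub>F r in at_right 0. \<forall>u v d.
    (\<forall>q\<in>prony_index N l. \<bar>u q\<bar> \<le> r \<and> \<bar>v q\<bar> \<le> r \<and> \<bar>u q - v q\<bar> \<le> d) \<longrightarrow>
    \<bar>prony_moment N l (shifted_coeff l a u) (shifted_node l a x u) k
      - prony_moment N l (shifted_coeff l a v) (shifted_node l a x v) k
      - (\<Sum>(j, i)\<in>prony_index N l. power_deriv k i (x j) * (u (j, i) - v (j, i)))\<bar> \<le> e * d"
proof -
  define L where "L = 1 + real (\<Sum>j=1..N. l j)"
  have L: "L \<ge> 1"
    by (simp add: L_def sum_nonneg)
  define term_diff where "term_diff u v j i =
    shifted_coeff l a u i j * power_deriv k i (shifted_node l a x u j)
      - shifted_coeff l a v i j * power_deriv k i (shifted_node l a x v j)" for u v j i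
  define linear_part where "linear_part u v j i =
      power_deriv k i (x j) * (u (j, i) - v (j, i) - prev_ratio l a i j * (u (j, l j) - v (j, l j)))
         + a i j * power_deriv k (Suc i) (x j) * ((u (j, l j) - v (j, l j)) / a (l j - 1) j)"
    for u v :: "nat \<times> nat \<Rightarrow> real" and j i
  have "\<forall>\<^sub>F r in at_right 0. \<forall>j\<in>{1..N}. \<forall>i\<in>{..<l j}. \<forall>u v d.
    (\<forall>q\<in>prony_index N l. \<bar>u q\<bar> \<le> r \<and> \<bar>v q\<bar> \<le> r \<and> \<bar>u q - v q\<bar> \<le> d) \<longrightarrow>
    \<bar>term_diff u v j i - linear_part u v j i\<bar> \<le> e / L * d"
    unfolding term_diff_def linear_part_def using \<open>e > 0\<close> L a
    by (intro eventually_ball_finite ballI eventually_term_almost_linear) auto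
  then show ?thesis
  proof eventually_elim
    case (elim r)
    show ?case
    proof (intro allI impI)
      fix u v :: "nat \<times> nat \<Rightarrow> real" and d
      assume *: "\<forall>q\<in>prony_index N l. \<bar>u q\<bar> \<le> r \<and> \<bar>v q\<bar> \<le> r \<and> \<bar>u q - v q\<bar> \<le> d"
      have index_sum: "(\<Sum>(j, i)\<in>prony_index N l. power_deriv k i (x j) * (u (j, i) - v (j, i)))
          = (\<Sum>j=1..N. \<Sum>i\<le>l j. power_deriv k i (x j) * (u (j, i) - v (j, i)))"
        by (simp add: prony_index_def sum.Sigma)
      also have "\<dots> = (\<Sum>j=1..N. \<Sum>i<l j. linear_part u v j i)"
      proof (rule sum.cong[OF refl])
        fix j assume j: "j \<in> {1..N}"
        then show "(\<Sum>i\<le>l j. power_deriv k i (x j) * (u (j, i) - v (j, i)))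
            = (\<Sum>i<l j. linear_part u v j i)"
          unfolding linear_part_def
          using l a block_linearization[of l j a "\<lambda>i. power_deriv k i (x j)" "\<lambda>q. u q - v q"]
          by simp
      qed
      finally have lin: "(\<Sum>(j, i)\<in>prony_index N l. power_deriv k i (x j) * (u (j, i) - v (j, i)))
          = (\<Sum>j=1..N. \<Sum>i<l j. linear_part u v j i)" .
      have "\<bar>\<Sum>j=1..N. \<Sum>i<l j. term_diff u v j i - linear_part u v j i\<bar>
          \<le> (\<Sum>j=1..N. \<Sum>i<l j. e / L * d)"
        using elim[rule_format, of _ _ u v d] *
        by (intro order.trans[OF sum_abs] sum_mono) auto
      also have "\<dots> = real (\<Sum>j=1..N. l j) * (e / L * d)"
        by (simp only: sum_constant card_lessThan of_nat_sum sum_distrib_right)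
      also have "\<dots> \<le> L * (e / L * d)"
      proof -
        have "(1, 0) \<in> prony_index N l"
          using \<open>N \<ge> 1\<close> by (simp add: prony_index_def)
        then have "d \<ge> 0"
          using * by force
        then show ?thesis
          using \<open>e > 0\<close> L by (intro mult_right_mono) (auto simp: L_def)
      qed
      also have "\<dots> = e * d"
        using L by simp
      finally show "\<bar>prony_moment N l (shifted_coeff l a u) (shifted_node l a x u) k
      - prony_moment N l (shifted_coeff l a v) (shifted_node l a x v) k
      - (\<Sum>(j, i)\<in>prony_index N l. power_deriv k i (x j) * (u (j, i) - v (j, i)))\<bar> \<le> e * d"
        unfolding lin
        by (simp add: term_diff_def prony_moment_eq_power_deriv sum_subtractf)
    qed
  qed
qed

section \<open>Passing between parameters and adapted coordinates\<close>

lemma prony_moment_cong: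
  assumes "\<And>j. j \<in> {1..N} \<Longrightarrow> x j = y j" "\<And>i j. j \<in> {1..N} \<Longrightarrow> i < l j \<Longrightarrow> a i j = b i j"
  shows "prony_moment N l a x k = prony_moment N l b y k"
  using assms by (simp add: prony_moment_def)

text \<open>The coordinates of given parameters \<open>b\<close> and \<open>y\<close>, a right inverse of \<open>shifted_coeff\<close> and
  \<open>shifted_node\<close>.\<close>
definition parameter_shift ::
  "(nat \<Rightarrow> nat) \<Rightarrow> (nat \<Rightarrow> nat \<Rightarrow> real) \<Rightarrow> (nat \<Rightarrow> real) \<Rightarrow> (nat \<Rightarrow> nat \<Rightarrow> real) \<Rightarrow> (nat \<Rightarrow> real)
     \<Rightarrow> nat \<times> nat \<Rightarrow> real" where
  "parameter_shift l a x b y = (\<lambda>(j, i).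
     if i = l j then a (l j - 1) j * (y j - x j)
     else b i j - a i j + prev_ratio l a i j * (a (l j - 1) j * (y j - x j)))"

lemma shifted_parameter_shift:
  assumes "a (l j - 1) j \<noteq> 0"
  shows "shifted_node l a x (parameter_shift l a x b y) j = y j"
    and "i < l j \<Longrightarrow> shifted_coeff l a (parameter_shift l a x b y) i j = b i j"
  using assms by (auto simp: shifted_node_def shifted_coeff_def parameter_shift_def)

text \<open>
  Uniqueness is claimed for parameters in a box around \<open>(a, x)\<close>, but proved in a box of
  adapted coordinates; this controls the latter by the former.
\<close>
lemma abs_parameter_shift_le:
  assumes near: "prony_near N l r a x b y" and a: "\<forall>j\<in>{1..N}. a (l j - 1) j \<noteq> 0"
    and B: "\<forall>j\<in>{1..N}. \<bar>a (l j - 1) j\<bar> \<le> B \<and> (\<forall>i<l j. 1 + \<bar>a (i - 1) j\<bar> \<le> B)"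
    and p: "p \<in> prony_index N l"
  shows "\<bar>parameter_shift l a x b y p\<bar> \<le> B * r"
proof -
  obtain j i where ji: "p = (j, i)" "j \<in> {1..N}" "i \<le> l j"
    using p by (auto simp: prony_index_def)
  have yx: "\<bar>y j - x j\<bar> \<le> r"
    using near ji by (force simp: prony_near_def)
  show ?thesis
  proof (cases "i = l j")
    case True
    have "\<bar>a (l j - 1) j * (y j - x j)\<bar> \<le> B * r"
      unfolding abs_mult using B ji yx by (intro mult_mono) force+
    then show ?thesis
      using True ji by (simp add: parameter_shift_def)
  next
    case False
    then have i: "i < l j"
      using ji by simp
    have "\<bar>prev_ratio l a i j * (a (l j - 1) j * (y j - x j))\<bar> \<le> \<bar>a (i - 1) j\<bar> * r"
      using a ji yx by (auto simp: prev_ratio_def abs_mult mult_left_mono)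
    moreover have "\<bar>b i j - a i j\<bar> \<le> r"
      using near ji i by (force simp: prony_near_def)
    ultimately have "\<bar>b i j - a i j + prev_ratio l a i j * (a (l j - 1) j * (y j - x j))\<bar>
        \<le> (1 + \<bar>a (i - 1) j\<bar>) * r"
      unfolding distrib_right by linarith
    also have "\<dots> \<le> B * r"
      using B ji i yx by (intro mult_right_mono) auto
    finally show ?thesis
      using i ji by (simp add: parameter_shift_def)
  qed
qed

text \<open>
  The source of the factors in the theorem: a node is divided by the leading coefficient, and a
  coefficient with \<open>i > 0\<close> is corrected by \<open>prev_ratio\<close> times a coordinate.
\<close>
lemma shifted_parameter_bounds:
  assumes a: "a (l j - 1) j \<noteq> 0" and j: "j \<in> {1..N}"
    and u: "\<And>p. p \<in> prony_index N l \<Longrightarrow> \<bar>u p\<bar> \<le> d"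
  shows "\<bar>shifted_node l a x u j - x j\<bar> \<le> d * (1 / \<bar>a (l j - 1) j\<bar>)"
    and "i < l j \<Longrightarrow> \<bar>shifted_coeff l a u i j - a i j\<bar> \<le>
      (if i = 0 then d else d * (1 + \<bar>a (i - 1) j\<bar> / \<bar>a (l j - 1) j\<bar>))"
proof -
  have ul: "\<bar>u (j, l j)\<bar> \<le> d"
    using u j by (auto simp: prony_index_def)
  then show "\<bar>shifted_node l a x u j - x j\<bar> \<le> d * (1 / \<bar>a (l j - 1) j\<bar>)"
    by (simp add: shifted_node_def divide_right_mono)
  assume i: "i < l j"
  have ui: "\<bar>u (j, i)\<bar> \<le> d"
    using u i j by (auto simp: prony_index_def)
  have "\<bar>prev_ratio l a i j * u (j, l j)\<bar> \<le> \<bar>prev_ratio l a i j\<bar> * d"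
    using ul by (auto simp: abs_mult mult_left_mono)
  with ui have "\<bar>u (j, i) - prev_ratio l a i j * u (j, l j)\<bar> \<le> d * (1 + \<bar>prev_ratio l a i j\<bar>)"
    unfolding distrib_left using abs_triangle_ineq4[of "u (j, i)" "prev_ratio l a i j * u (j, l j)"]
    by (simp add: mult.commute)
  then show "\<bar>shifted_coeff l a u i j - a i j\<bar> \<le>
      (if i = 0 then d else d * (1 + \<bar>a (i - 1) j\<bar> / \<bar>a (l j - 1) j\<bar>))"
    by (auto simp: shifted_coeff_def prev_ratio_def abs_divide)
qed

section \<open>Local solvability and stability of the confluent Prony system\<close>

theorem theorem4:
  fixes N :: nat and l :: "nat \<Rightarrow> nat" and x :: "nat \<Rightarrow> real"
  assumes "N \<ge> 1"
    and "inj_on x {1..N}"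
    and "\<forall>j\<in>{1..N}. l j \<ge> 1"
  shows "\<exists>C\<^sub>2>0. \<forall>a :: nat \<Rightarrow> nat \<Rightarrow> real. (\<forall>j\<in>{1..N}. a (l j - 1) j \<noteq> 0) \<longrightarrow>
    (\<exists>r>0. \<exists>\<epsilon>\<^sub>0>0. \<forall>\<epsilon>. 0 < \<epsilon> \<and> \<epsilon> < \<epsilon>\<^sub>0 \<longrightarrow>
      (\<forall>m' :: nat \<Rightarrow> real.
        (MAX k\<in>{..<prony_size N l}. \<bar>prony_moment N l a x k - m' k\<bar>) < \<epsilon> \<longrightarrow>
        (\<exists>a' x'.
          prony_solution N l m' a' x' \<and> prony_near N l r a x a' x' \<and>
          (\<forall>b y. prony_solution N l m' b y \<and> prony_near N l r a x b y \<longrightarrow>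
             (\<forall>j\<in>{1..N}. y j = x' j \<and> (\<forall>i<l j. b i j = a' i j))) \<and>
          (\<forall>j\<in>{1..N}.
             (\<forall>i<l j. \<bar>a' i j - a i j\<bar> \<le>
                (if i = 0 then C\<^sub>2 * \<epsilon>
                 else C\<^sub>2 * \<epsilon> * (1 + \<bar>a (i - 1) j\<bar> / \<bar>a (l j - 1) j\<bar>))) \<and>
             \<bar>x' j - x j\<bar> \<le> C\<^sub>2 * \<epsilon> * (1 / \<bar>a (l j - 1) j\<bar>)))))"
proof -
  define I where "I = prony_index N l"
  define n where "n = prony_size N l"
  define V where "V k = (\<lambda>(j, i). power_deriv k i (x j))" for k
  have fin: "finite I"
    by (simp add: I_def prony_index_def)
  have size: "sum (\<lambda>j. Suc (l j)) {1..N} = n"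
    by (simp add: n_def prony_size_def sum_Suc)
  have card: "card I = n"
    by (simp add: I_def n_def card_prony_index)
  have kernel: "\<forall>k<n. c k = 0" if "\<forall>q\<in>I. (\<Sum>k<n. c k * V k q) = 0" for c
  proof (intro allI impI)
    fix k assume k: "k < n"
    show "c k = 0"
    proof (rule confluent_vandermonde_left_kernel[OF assms(2), of "\<lambda>j. Suc (l j)" c k, unfolded size])
      fix j i assume "j \<in> {1..N}" "i < Suc (l j)"
      then show "(\<Sum>k<n. c k * power_deriv k i (x j)) = 0"
        using that[rule_format, of "(j, i)"] by (simp add: V_def I_def prony_index_def)
    qed (use k in auto)
  qed
  obtain W where W:
    "\<And>p q. p \<in> I \<Longrightarrow> q \<in> I \<Longrightarrow> (\<Sum>k<n. W p k * V k q) = (if p = q then 1 else 0)"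
    "\<And>k k'. k < n \<Longrightarrow> k' < n \<Longrightarrow> (\<Sum>p\<in>I. V k p * W p k') = (if k = k' then 1 else 0)"
    using inverse_of_trivial_left_kernel[OF fin card kernel] by blast
  define C where "C = 1 + (\<Sum>p\<in>I. \<Sum>k<n. \<bar>W p k\<bar>)"
  have C: "C \<ge> 1"
    by (simp add: C_def sum_nonneg)
  have row_sum: "(\<Sum>k<n. \<bar>W p k\<bar>) \<le> C" if "p \<in> I" for p
    using member_le_sum[of p I "\<lambda>p. \<Sum>k<n. \<bar>W p k\<bar>"] fin that
    by (simp add: C_def sum_nonneg)
  show ?thesis
  proof (rule exI[of _ "2 * C"], intro conjI allI impI)
    show "2 * C > 0"
      using C by simp
    fix a :: "nat \<Rightarrow> nat \<Rightarrow> real"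
    assume a: "\<forall>j\<in>{1..N}. a (l j - 1) j \<noteq> 0"
    define G where "G u k = prony_moment N l (shifted_coeff l a u) (shifted_node l a x u) k" for u k
    define e where "e = 1 / (2 * C)"
    have e: "e > 0" "C * e \<le> 1 / 2"
      using C by (auto simp: e_def)
    \<comment> \<open>In contrast to \<open>V\<close>, \<open>W\<close> and \<open>C\<close>, the radius \<open>\<rho>\<close> depends on \<open>a\<close>.\<close>
    have "\<forall>\<^sub>F \<rho> in at_right 0. \<rho> > 0 \<and> (\<forall>k\<in>{..<n}. \<forall>u v d.
      (\<forall>q\<in>I. \<bar>u q\<bar> \<le> \<rho> \<and> \<bar>v q\<bar> \<le> \<rho> \<and> \<bar>u q - v q\<bar> \<le> d) \<longrightarrow>
      \<bar>G u k - G v k - (\<Sum>(j, i)\<in>I. power_deriv k i (x j) * (u (j, i) - v (j, i)))\<bar> \<le> e * d)"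
      unfolding G_def I_def using e a assms
      by (intro eventually_conj eventually_at_right_less eventually_ball_finite ballI
          eventually_moments_almost_linear) auto
    then obtain \<rho> where \<rho>: "\<rho> > 0"
      and almost_linear: "\<And>k u v d. k < n \<Longrightarrow>
        \<forall>q\<in>I. \<bar>u q\<bar> \<le> \<rho> \<and> \<bar>v q\<bar> \<le> \<rho> \<and> \<bar>u q - v q\<bar> \<le> d \<Longrightarrow>
        \<bar>G u k - G v k - (\<Sum>(j, i)\<in>I. power_deriv k i (x j) * (u (j, i) - v (j, i)))\<bar> \<le> e * d"
      using eventually_happens'[OF trivial_limit_at_right_real] by (smt (verit) lessThan_iff)
    interpret almost_linear_system I n V W G C e \<rho>
    proof
      fix u v :: "nat \<times> nat \<Rightarrow> real" and d k
      assume "\<forall>q\<in>I. \<bar>u q\<bar> \<le> \<rho>" "\<forall>q\<in>I. \<bar>v q\<bar> \<le> \<rho>" "\<forall>q\<in>I. \<bar>u q - v q\<bar> \<le> d" "k < n"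
      then show "\<bar>G u k - G v k - (\<Sum>p\<in>I. V k p * (u p - v p))\<bar> \<le> e * d"
        using almost_linear[of k u v d] by (simp add: V_def case_prod_unfold)
    qed (use fin W row_sum e in auto)
    have "\<forall>\<^sub>F B in at_top. 1 \<le> B \<and> (\<forall>j\<in>{1..N}. \<bar>a (l j - 1) j\<bar> \<le> B \<and> 1 / \<bar>a (l j - 1) j\<bar> \<le> B \<and>
      (\<forall>i\<in>{..<l j}. 1 + \<bar>a (i - 1) j\<bar> \<le> B \<and> 1 + \<bar>a (i - 1) j\<bar> / \<bar>a (l j - 1) j\<bar> \<le> B))"
      by (intro eventually_conj eventually_ball_finite ballI eventually_ge_at_top) auto
    then obtain B where B: "1 \<le> B" "\<And>j. j \<in> {1..N} \<Longrightarrow> \<bar>a (l j - 1) j\<bar> \<le> B"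
      "\<And>j. j \<in> {1..N} \<Longrightarrow> 1 / \<bar>a (l j - 1) j\<bar> \<le> B"
      "\<And>i j. j \<in> {1..N} \<Longrightarrow> i < l j \<Longrightarrow> 1 + \<bar>a (i - 1) j\<bar> \<le> B"
      "\<And>i j. j \<in> {1..N} \<Longrightarrow> i < l j \<Longrightarrow> 1 + \<bar>a (i - 1) j\<bar> / \<bar>a (l j - 1) j\<bar> \<le> B"
      by (auto dest!: eventually_happens'[OF trivial_limit_at_top_linorder])
    \<comment> \<open>\<open>B\<close> bounds the change of coordinates in both directions. Thus the parameter box of
      radius \<open>r\<close> lies in the coordinate box of radius \<open>\<rho>\<close>, and \<open>\<epsilon>\<^sub>0\<close> keeps the solution found in
      coordinates inside the parameter box.\<close>
    define r where "r = \<rho> / B"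
    define \<epsilon>\<^sub>0 where "\<epsilon>\<^sub>0 = r / (2 * C * B)"
    have r: "r > 0" "B * r = \<rho>"
      using \<rho> B(1) by (auto simp: r_def)
    have \<epsilon>\<^sub>0: "\<epsilon>\<^sub>0 > 0"
      using r B(1) C by (auto simp: \<epsilon>\<^sub>0_def)
    show "\<exists>r>0. \<exists>\<epsilon>\<^sub>0>0. \<forall>\<epsilon>. 0 < \<epsilon> \<and> \<epsilon> < \<epsilon>\<^sub>0 \<longrightarrow>
      (\<forall>m' :: nat \<Rightarrow> real.
        (MAX k\<in>{..<prony_size N l}. \<bar>prony_moment N l a x k - m' k\<bar>) < \<epsilon> \<longrightarrow>
        (\<exists>a' x'.
          prony_solution N l m' a' x' \<and> prony_near N l r a x a' x' \<and>
          (\<forall>b y. prony_solution N l m' b y \<and> prony_near N l r a x b y \<longrightarrow>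
             (\<forall>j\<in>{1..N}. y j = x' j \<and> (\<forall>i<l j. b i j = a' i j))) \<and>
          (\<forall>j\<in>{1..N}.
             (\<forall>i<l j. \<bar>a' i j - a i j\<bar> \<le>
                (if i = 0 then 2 * C * \<epsilon>
                 else 2 * C * \<epsilon> * (1 + \<bar>a (i - 1) j\<bar> / \<bar>a (l j - 1) j\<bar>))) \<and>
             \<bar>x' j - x j\<bar> \<le> 2 * C * \<epsilon> * (1 / \<bar>a (l j - 1) j\<bar>))))"
    proof (rule exI[of _ r], rule conjI, rule r(1), rule exI[of _ \<epsilon>\<^sub>0], rule conjI, rule \<epsilon>\<^sub>0,
        intro allI impI)
      fix \<epsilon> and m' :: "nat \<Rightarrow> real"
      assume \<epsilon>: "0 < \<epsilon> \<and> \<epsilon> < \<epsilon>\<^sub>0"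
        and "(MAX k\<in>{..<prony_size N l}. \<bar>prony_moment N l a x k - m' k\<bar>) < \<epsilon>"
      then have max: "(MAX k\<in>{..<n}. \<bar>prony_moment N l a x k - m' k\<bar>) < \<epsilon>"
        by (simp add: n_def)
      have m': "\<bar>prony_moment N l a x k - m' k\<bar> \<le> \<epsilon>" if "k < n" for k
      proof -
        have "\<bar>prony_moment N l a x k - m' k\<bar> \<le> (MAX k\<in>{..<n}. \<bar>prony_moment N l a x k - m' k\<bar>)"
          using that by (intro Max_ge) auto
        with max show ?thesis
          by linarith
      qed
      define d where "d = 2 * C * \<epsilon>"
      have "\<epsilon> < r / (2 * C * B)"
        using \<epsilon> by (simp add: \<epsilon>\<^sub>0_def)
      then have "\<epsilon> * (2 * C * B) < r"
        using C B(1) by (subst (asm) pos_less_divide_eq) auto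
      then have d: "d > 0" "B * d < r"
        using \<epsilon> C by (auto simp: d_def algebra_simps)
      have "r \<le> \<rho>"
        using r B(1) mult_right_mono[of 1 B r] by simp
      moreover have "d \<le> B * d"
        using B(1) d(1) mult_right_mono[of 1 B d] by simp
      ultimately have "d \<le> \<rho>"
        using d(2) by linarith
      have G0: "G (\<lambda>_. 0) k = prony_moment N l a x k" for k
        by (simp add: G_def shifted_coeff_def [abs_def] shifted_node_def [abs_def])
      obtain u where u: "\<And>p. p \<in> I \<Longrightarrow> \<bar>u p\<bar> \<le> d" "\<And>k. k < n \<Longrightarrow> G u k = m' k"
        using solution_exists[of m' \<epsilon>] m' \<epsilon> C \<open>d \<le> \<rho>\<close> unfolding G0 d_def by auto
      define a' where "a' = shifted_coeff l a u"
      define x' where "x' = shifted_node l a x u"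
      have x'_le: "\<bar>x' j - x j\<bar> \<le> d * (1 / \<bar>a (l j - 1) j\<bar>)" if "j \<in> {1..N}" for j
        unfolding x'_def using that a u(1) unfolding I_def by (intro shifted_parameter_bounds) auto
      have a'_le: "\<bar>a' i j - a i j\<bar> \<le>
        (if i = 0 then d else d * (1 + \<bar>a (i - 1) j\<bar> / \<bar>a (l j - 1) j\<bar>))"
        if "j \<in> {1..N}" "i < l j" for i j
        unfolding a'_def using that a u(1) unfolding I_def by (intro shifted_parameter_bounds) auto
      have solution: "prony_solution N l m' a' x'"
        using u(2) by (simp add: prony_solution_def a'_def x'_def G_def n_def)
      have near: "prony_near N l r a x a' x'"
        unfolding prony_near_def
      proof (intro ballI conjI allI impI)
        fix j assume j: "j \<in> {1..N}"
        have "d * (1 / \<bar>a (l j - 1) j\<bar>) \<le> d * B"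
          using B(3)[OF j] d by (intro mult_left_mono) auto
        then show "\<bar>x' j - x j\<bar> < r"
          using x'_le[OF j] d by (simp add: mult.commute)
        fix i assume i: "i < l j"
        have "d * (1 + \<bar>a (i - 1) j\<bar> / \<bar>a (l j - 1) j\<bar>) \<le> d * B"
          using B(5)[OF j i] d by (intro mult_left_mono) auto
        then show "\<bar>a' i j - a i j\<bar> < r"
          using a'_le[OF j i] d(2) \<open>d \<le> B * d\<close> unfolding mult.commute[of d B]
          by (cases "i = 0"; simp only: simp_thms if_True if_False; linarith)
      qed
      have unique: "y j = x' j \<and> (\<forall>i<l j. b i j = a' i j)"
        if by_: "prony_solution N l m' b y" "prony_near N l r a x b y" and j: "j \<in> {1..N}" for b y j
      proof -
        define v where "v = parameter_shift l a x b y"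
        have v: "shifted_node l a x v j = y j" "i < l j \<Longrightarrow> shifted_coeff l a v i j = b i j"
          if "j \<in> {1..N}" for i j
          using shifted_parameter_shift a that by (auto simp: v_def)
        have "G v k = m' k" if "k < n" for k
        proof -
          have "G v k = prony_moment N l b y k"
            unfolding G_def using v by (intro prony_moment_cong) auto
          then show ?thesis
            using by_(1) that by (simp add: prony_solution_def n_def)
        qed
        moreover have "\<bar>v p\<bar> \<le> \<rho>" if "p \<in> I" for p
          unfolding v_def r(2)[symmetric] using by_(2) a B that unfolding I_def
          by (intro abs_parameter_shift_le) auto
        moreover have "\<bar>u p\<bar> \<le> \<rho>" if "p \<in> I" for p
          using u(1)[OF that] \<open>d \<le> \<rho>\<close> by simp
        ultimately have "v p = u p" if "p \<in> I" for p
          using that u(2) by (intro solution_unique[of v u p]) auto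
        then have "v (j, i) = u (j, i)" if "i \<le> l j" for i
          using that j by (simp add: I_def prony_index_def)
        then have "shifted_node l a x v j = x' j" "\<forall>i<l j. shifted_coeff l a v i j = a' i j"
          by (simp_all add: x'_def a'_def shifted_node_def shifted_coeff_def)
        then show ?thesis
          by (simp add: v[OF j])
      qed
      show "\<exists>a' x'.
          prony_solution N l m' a' x' \<and> prony_near N l r a x a' x' \<and>
          (\<forall>b y. prony_solution N l m' b y \<and> prony_near N l r a x b y \<longrightarrow>
             (\<forall>j\<in>{1..N}. y j = x' j \<and> (\<forall>i<l j. b i j = a' i j))) \<and>
          (\<forall>j\<in>{1..N}.
             (\<forall>i<l j. \<bar>a' i j - a i j\<bar> \<le>
                (if i = 0 then 2 * C * \<epsilon>
                 else 2 * C * \<epsilon> * (1 + \<bar>a (i - 1) j\<bar> / \<bar>a (l j - 1) j\<bar>))) \<and>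
             \<bar>x' j - x j\<bar> \<le> 2 * C * \<epsilon> * (1 / \<bar>a (l j - 1) j\<bar>))"
      proof (intro exI[of _ a'] exI[of _ x'] conjI ballI allI impI)
        show "prony_solution N l m' a' x'"
          by (rule solution)
        show "prony_near N l r a x a' x'"
          by (rule near)
      next
        fix b y j
        assume "prony_solution N l m' b y \<and> prony_near N l r a x b y" "j \<in> {1..N}"
        then show "y j = x' j"
          using unique by blast
      next
        fix b y j i
        assume "prony_solution N l m' b y \<and> prony_near N l r a x b y" "j \<in> {1..N}" "i < l j"
        then show "b i j = a' i j"
          using unique by blast
      qed (use x'_le a'_le in \<open>auto simp only: d_def\<close>)
    qed
  qed
qed

end
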